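(* Let $k$ be a field and let $M=M_{3,5}=(x_{i,j})$ be the generic $3\times5$ matrix over $k$. (1) If $\operatorname{char}k\ne2,3$, then any minimal prime over $I_3(3,5)$ either contains all the entries of some column of $M$, or contains all the $2\times2$ permanents of the $2\times 5$ submatrix formed by some two rows of $M$. (2) If $\operatorname{char}k=3$, then any prime containing $I_3(3,5)$ that contains neither all the entries of a column of $M$ nor all the $2\times2$ permanents of some two rows of $M$ must contain all the $2\times2$ minors of the $3\times4$ submatrix formed by some collection of $4$ columns of $M$.
   Context: The permanent of an $n\times n$ matrix $(a_{i,j})$ over a commutative ring is $\sum_{\sigma\in S_n}a_{1,\sigma(1)}\cdots a_{n,\sigma(n)}$. The generic matrix $M_{3,5}=(x_{i,j})$ has independent indeterminates as entries, and $I_3(3,5)\subset k[x_{i,j}]$ is the ideal generated by the permanents of all $3\times3$ submatrices of $M_{3,5}$. The $r\times r$ permanents of a matrix are the permanents of its $r\times r$ submatrices. *)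

theory Defs
  imports
    "HOL-Library.Poly_Mapping"
    "HOL-Library.Numeral_Type"
    "HOL-Algebra.Algebraic_Closure_Type"
    "Jordan_Normal_Form.Determinant"
    "Jordan_Normal_Form.DL_Submatrix"
begin

definition permanent :: "'a::comm_ring_1 mat \<Rightarrow> 'a" where
  "permanent A = (if dim_row A = dim_col A then
     (\<Sum>\<sigma> | \<sigma> permutes {0..<dim_row A}. \<Prod>i = 0..<dim_row A. A $$ (i, \<sigma> i)) else 0)"

definition permanents :: "nat \<Rightarrow> 'a::comm_ring_1 mat \<Rightarrow> 'a set" where
  "permanents r A = {permanent (submatrix A I J) | I J.
     I \<subseteq> {..<dim_row A} \<and> J \<subseteq> {..<dim_col A} \<and> card I = r \<and> card J = r}"

definition minors :: "nat \<Rightarrow> 'a::comm_ring_1 mat \<Rightarrow> 'a set" where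
  "minors r A = {det (submatrix A I J) | I J.
     I \<subseteq> {..<dim_row A} \<and> J \<subseteq> {..<dim_col A} \<and> card I = r \<and> card J = r}"

definition permanental_ideal :: "nat \<Rightarrow> 'a::comm_ring_1 mat \<Rightarrow> 'a set" where
  "permanental_ideal r A = Idl\<^bsub>ring_of_type_algebra\<^esub> (permanents r A)"

definition minimal_prime_over :: "('a, 'b) ring_scheme \<Rightarrow> 'a set \<Rightarrow> 'a set \<Rightarrow> bool" where
  "minimal_prime_over R I P \<longleftrightarrow> primeideal P R \<and> I \<subseteq> P \<and>
     (\<forall>Q. primeideal Q R \<and> I \<subseteq> Q \<and> Q \<subseteq> P \<longrightarrow> Q = P)"

text \<open>
  The polynomial ring \<open>k[x\<^sub>i\<^sub>j]\<close> in the 15 indeterminates of a generic \<open>3 \<times> 5\<close> matrix: finitely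
  supported maps from monomials (exponent vectors indexed by the 15-element type \<open>3 \<times> 5\<close>) to
  coefficients, multiplied by convolution.
\<close>

type_synonym 'k poly35 = "((3 \<times> 5) \<Rightarrow>\<^sub>0 nat) \<Rightarrow>\<^sub>0 'k"

definition indet :: "3 \<times> 5 \<Rightarrow> 'k::field poly35" where
  "indet v = Poly_Mapping.single (Poly_Mapping.single v 1) 1"

text \<open>
  Matrix positions are natural numbers \<open>i < 3\<close>, \<open>j < 5\<close>, and \<open>of_nat\<close> identifies them with the
  elements of the index types \<open>3\<close> and \<open>5\<close>.
\<close>

definition generic_matrix_3_5 :: "'k::field poly35 mat" where
  "generic_matrix_3_5 = mat 3 5 (\<lambda>(i, j). indet (of_nat i, of_nat j))"

lemma bij_betw_of_nat_3: "bij_betw (of_nat :: nat \<Rightarrow> 3) {..<3} UNIV"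
proof -
  have "inj_on (of_nat :: nat \<Rightarrow> 3) {..<3}"
    by (auto simp: inj_on_def lessThan_nat_numeral lessThan_Suc)
  then have "card ((of_nat :: nat \<Rightarrow> 3) ` {..<3}) = CARD(3)"
    by (simp add: card_image)
  with \<open>inj_on _ _\<close> show ?thesis
    by (metis bij_betw_def card_subset_eq finite_class.finite_UNIV top_greatest)
qed

lemma bij_betw_of_nat_5: "bij_betw (of_nat :: nat \<Rightarrow> 5) {..<5} UNIV"
proof -
  have "inj_on (of_nat :: nat \<Rightarrow> 5) {..<5}"
    by (auto simp: inj_on_def lessThan_nat_numeral lessThan_Suc)
  then have "card ((of_nat :: nat \<Rightarrow> 5) ` {..<5}) = CARD(5)"
    by (simp add: card_image)
  with \<open>inj_on _ _\<close> show ?thesis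
    by (metis bij_betw_def card_subset_eq finite_class.finite_UNIV top_greatest)
qed

end

theory Submission
  imports Defs
begin

text \<open>
  Read the matrix modulo the prime ideal, that is, over the fraction field of the quotient domain,
  in which 2 is invertible.
  The \<open>3 \<times> 3\<close> permanent is then a symmetric trilinear form \<open>T\<close> vanishing on any three distinct of five
  nonzero columns, and \<open>T(u,v,w) = (u * v) \<cdot> w\<close>, where \<open>u * v\<close> is the vector of the three \<open>2 \<times> 2\<close>
  permanents of \<open>(u,v)\<close>.

  If three columns are independent, then \<open>u * v = 0\<close> for the other two columns \<open>u, v\<close>. Hence \<open>u\<close> and
  \<open>v\<close> share a zero coordinate, and either both are multiples of one unit vector, which yields two
  rows with vanishing \<open>2 \<times> 2\<close> permanents, or the three columns turn out to be dependent.

  If \<open>p\<close> is proportional to three of the columns, then \<open>T(p,p,\<cdot>)\<close> vanishes on all columns. Either \<open>p\<close> has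
  a zero coordinate, and then two rows are found directly, or \<open>T(p,p,p) = 6p\<^sub>1p\<^sub>2p\<^sub>3 = 0\<close> forces
  characteristic 3. In the latter case, for the other two columns \<open>d, e\<close>, \<open>T(p,d,e)\<close> is up to a unit
  the product of \<open>p\<^sub>2d\<^sub>1 - p\<^sub>1d\<^sub>2\<close> and \<open>p\<^sub>2e\<^sub>1 - p\<^sub>1e\<^sub>2\<close>, so a fourth column is proportional to \<open>p\<close>.

  Otherwise the columns span a plane and no three are proportional. For any two of them the linear form
  \<open>T(u,v,\<cdot>)\<close> vanishes on two independent columns, hence on the plane; since three columns are pairwise
  independent, \<open>T\<close> vanishes identically on the plane, which must then be a coordinate plane, and a row
  is zero.

  Divisions are avoided by exhibiting a multiple of each claimed element of \<open>P\<close>, by a factor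
  outside \<open>P\<close>, as an explicit linear combination of known elements of \<open>P\<close>.
\<close>

section \<open>Small permanents and determinants\<close>

lemma permanent_2:
  assumes "dim_row A = 2" "dim_col A = 2"
  shows "permanent A = A $$ (0,0) * A $$ (1,1) + A $$ (0,1) * A $$ (1,0)"
proof -
  have S: "{0..<2::nat} = insert 0 (insert 1 {})" by auto
  show ?thesis
    unfolding permanent_def assms S
    by (simp add: sum_over_permutations_insert )
qed

lemma permanent_3:
  assumes "dim_row A = 3" "dim_col A = 3"
  shows "permanent A =
      A $$ (0,0) * A $$ (1,1) * A $$ (2,2) + A $$ (0,0) * A $$ (1,2) * A $$ (2,1)
    + A $$ (0,1) * A $$ (1,0) * A $$ (2,2) + A $$ (0,1) * A $$ (1,2) * A $$ (2,0)
    + A $$ (0,2) * A $$ (1,0) * A $$ (2,1) + A $$ (0,2) * A $$ (1,1) * A $$ (2,0)"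
proof -
  have S: "{0..<3::nat} = insert 0 (insert 1 (insert 2 {}))" by auto
  show ?thesis
    unfolding permanent_def assms S
    by (simp add: sum_over_permutations_insert transpose_def)
qed

lemma det_2:
  assumes "dim_row A = 2" "dim_col A = 2"
  shows "det A = A $$ (0,0) * A $$ (1,1) - A $$ (0,1) * A $$ (1,0)"
proof -
  have S: "{0..<2::nat} = insert 0 (insert 1 {})" by auto
  show ?thesis
    unfolding det_def assms S
    by (simp add: sum_over_permutations_insert sign_swap_id)
qed

section \<open>Matrices modulo a prime ideal\<close>

definition perm2 :: "(nat \<Rightarrow> nat \<Rightarrow> 'a::comm_ring_1) \<Rightarrow> nat \<Rightarrow> nat \<Rightarrow> nat \<Rightarrow> nat \<Rightarrow> 'a" where
  "perm2 A r s i j = A r i * A s j + A s i * A r j"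

definition det2 :: "(nat \<Rightarrow> nat \<Rightarrow> 'a::comm_ring_1) \<Rightarrow> nat \<Rightarrow> nat \<Rightarrow> nat \<Rightarrow> nat \<Rightarrow> 'a" where
  "det2 A r s i j = A r i * A s j - A s i * A r j"

definition perm3 :: "(nat \<Rightarrow> nat \<Rightarrow> 'a::comm_ring_1) \<Rightarrow> nat \<Rightarrow> nat \<Rightarrow> nat \<Rightarrow> nat \<Rightarrow> nat \<Rightarrow> nat \<Rightarrow> 'a" where
  "perm3 A r s t i j k = A r k * perm2 A s t i j + A s k * perm2 A r t i j + A t k * perm2 A r s i j"

definition det3 :: "(nat \<Rightarrow> nat \<Rightarrow> 'a::comm_ring_1) \<Rightarrow> nat \<Rightarrow> nat \<Rightarrow> nat \<Rightarrow> nat \<Rightarrow> nat \<Rightarrow> nat \<Rightarrow> 'a" where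
  "det3 A r s t i j k = A r k * det2 A s t i j - A s k * det2 A r t i j + A t k * det2 A r s i j"

lemmas poly_defs = perm2_def det2_def perm3_def det3_def

locale prime_mod =
  fixes P :: "'a::comm_ring_1 set"
  assumes prime_ideal: "primeideal P ring_of_type_algebra"
begin

text \<open>As a simp rule, \<open>mult_mem_iff\<close> strips factors known to lie outside
  \<open>P\<close>; this stands in for division in the fraction field.\<close>

lemma zero_mem [simp]: "0 \<in> P"
  and add_mem: "a \<in> P \<Longrightarrow> b \<in> P \<Longrightarrow> a + b \<in> P"
  and mult_mem: "a \<in> P \<Longrightarrow> b * a \<in> P"
  and mult_mem_iff [simp]: "a * b \<in> P \<longleftrightarrow> a \<in> P \<or> b \<in> P"
  and one_not_mem [simp]: "1 \<notin> P"
proof -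
  interpret primeideal P "ring_of_type_algebra :: 'a ring" by (rule prime_ideal)
  show "0 \<in> P" using additive_subgroup.zero_closed[OF additive_subgroup_axioms]
    by (simp add: ring_of_type_algebra_def)
  show "a \<in> P \<Longrightarrow> b \<in> P \<Longrightarrow> a + b \<in> P"
    using additive_subgroup.a_closed[OF additive_subgroup_axioms] by (simp add: ring_of_type_algebra_def)
  show mult: "a \<in> P \<Longrightarrow> b * a \<in> P" for a b
    using I_l_closed by (simp add: ring_of_type_algebra_def)
  show "a * b \<in> P \<longleftrightarrow> a \<in> P \<or> b \<in> P"
    using I_prime[of a b] mult[of a b] mult[of b a] by (auto simp: ring_of_type_algebra_def mult.commute)
  show "1 \<notin> P" using mult[of 1] I_notcarr by (auto simp: ring_of_type_algebra_def)
qed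

lemma uminus_mem [simp]: "- a \<in> P \<longleftrightarrow> a \<in> P"
  using mult_mem[of a "-1"] mult_mem[of "-a" "-1"] by auto

lemma diff_mem: "a \<in> P \<Longrightarrow> b \<in> P \<Longrightarrow> a - b \<in> P"
  using add_mem[of a "-b"] by simp

text \<open>Each use supplies the coefficients \<open>q1\<close>, \<open>q2\<close>, ... as a
  certificate, leaving a polynomial identity to be checked by normalization.\<close>

lemma lincomb_mem:
  "h1 \<in> P \<Longrightarrow> h2 \<in> P \<Longrightarrow> g = q1 * h1 + q2 * h2 \<Longrightarrow> g \<in> P"
  "h1 \<in> P \<Longrightarrow> h2 \<in> P \<Longrightarrow> h3 \<in> P \<Longrightarrow> g = q1 * h1 + q2 * h2 + q3 * h3 \<Longrightarrow> g \<in> P"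
  "h1 \<in> P \<Longrightarrow> h2 \<in> P \<Longrightarrow> h3 \<in> P \<Longrightarrow> h4 \<in> P \<Longrightarrow>
     g = q1 * h1 + q2 * h2 + q3 * h3 + q4 * h4 \<Longrightarrow> g \<in> P"
  "h1 \<in> P \<Longrightarrow> h2 \<in> P \<Longrightarrow> h3 \<in> P \<Longrightarrow> h4 \<in> P \<Longrightarrow> h5 \<in> P \<Longrightarrow>
     g = q1 * h1 + q2 * h2 + q3 * h3 + q4 * h4 + q5 * h5 \<Longrightarrow> g \<in> P"
  by (simp_all add: add_mem)

end

section \<open>Orderings of the rows and the standing assumptions\<close>

definition rows :: "nat \<Rightarrow> nat \<Rightarrow> nat \<Rightarrow> bool" where
  "rows r s t \<longleftrightarrow> (r, s, t) \<in> {(0,1,2), (0,2,1), (1,0,2), (1,2,0), (2,0,1), (2,1,0)}"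

lemma rows_lt: "rows r s t \<Longrightarrow> r < 3" "rows r s t \<Longrightarrow> s < 3" "rows r s t \<Longrightarrow> t < 3"
  by (auto simp: rows_def)

lemma rows_swap: "rows r s t \<Longrightarrow> rows s r t" "rows r s t \<Longrightarrow> rows r t s"
  by (auto simp: rows_def)

lemma rows_complete: "r < 3 \<Longrightarrow> \<exists>s t. rows r s t"
proof -
  assume "r < 3"
  then have "r = 0 \<or> r = 1 \<or> r = 2" by linarith
  then show ?thesis by (auto simp: rows_def)
qed

locale vanishing_permanents = prime_mod P for P :: "'a::comm_ring_1 set" +
  fixes A :: "nat \<Rightarrow> nat \<Rightarrow> 'a"
  assumes perm3_mem_012: "\<lbrakk>i < 5; j < 5; k < 5; distinct [i, j, k]\<rbrakk> \<Longrightarrow> perm3 A 0 1 2 i j k \<in> P"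
    and two_not_mem [simp]: "2 \<notin> P"
    and column_nonzero: "j < 5 \<Longrightarrow> \<exists>r<3. A r j \<notin> P"
begin

text \<open>Since all columns are nonzero modulo \<open>P\<close>, this is proportionality over the
  fraction field, an equivalence relation on the columns.\<close>

definition par :: "nat \<Rightarrow> nat \<Rightarrow> bool" where
  "par i j \<longleftrightarrow> (\<forall>r<3. \<forall>s<3. det2 A r s i j \<in> P)"

definition good_rows :: "nat \<Rightarrow> nat \<Rightarrow> bool" where
  "good_rows r s \<longleftrightarrow> (\<forall>i<5. \<forall>j<5. i \<noteq> j \<longrightarrow> perm2 A r s i j \<in> P)"

lemma perm3_rows: "rows r s t \<Longrightarrow> perm3 A r s t i j k = perm3 A 0 1 2 i j k"
  by (auto simp: rows_def poly_defs algebra_simps)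

lemma perm3_cols:
  "perm3 A r s t j i k = perm3 A r s t i j k"
  "perm3 A r s t i k j = perm3 A r s t i j k"
  by (simp_all add: poly_defs algebra_simps)

lemma det3_mem_rows:
  assumes "rows r s t"
  shows "det3 A r s t i j k \<in> P \<longleftrightarrow> det3 A 0 1 2 i j k \<in> P"
proof -
  have "det3 A r s t i j k = det3 A 0 1 2 i j k \<or> det3 A r s t i j k = - det3 A 0 1 2 i j k"
    using assms by (auto simp: rows_def poly_defs algebra_simps)
  then show ?thesis by auto
qed

lemma perm3_mem:
  "\<lbrakk>rows r s t; i < 5; j < 5; k < 5; distinct [i, j, k]\<rbrakk> \<Longrightarrow> perm3 A r s t i j k \<in> P"
  using perm3_mem_012[of i j k] by (simp add: perm3_rows)

lemma column_nonzeroE: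
  assumes "j < 5"
  obtains r s t where "rows r s t" "A r j \<notin> P"
  using column_nonzero[OF assms] rows_complete that by blast

lemma par_refl: "par i i"
  by (simp add: par_def det2_def)

lemma par_sym: "par i j \<Longrightarrow> par j i"
proof -
  have "det2 A r s j i = - det2 A r s i j" for r s by (simp add: det2_def algebra_simps)
  then show "par i j \<Longrightarrow> par j i" by (simp add: par_def)
qed

text \<open>An entry \<open>A q j\<close> outside \<open>P\<close> of the middle column plays the
  role of a denominator.\<close>

lemma par_trans:
  assumes "par i j" "par j k" "j < 5"
  shows "par i k"
  unfolding par_def
proof (intro allI impI)
  fix r s :: nat assume rs: "r < 3" "s < 3"
  obtain q where q: "q < 3" "A q j \<notin> P" using column_nonzero assms(3) by auto
  have "A q j * det2 A r s i k \<in> P"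
  proof (rule lincomb_mem(2))
    show "det2 A r q i j \<in> P" "det2 A s q i j \<in> P" "det2 A r s j k \<in> P"
      using assms q rs by (auto simp: par_def)
    show "A q j * det2 A r s i k = A s k * det2 A r q i j + (- A r k) * det2 A s q i j
       + A q i * det2 A r s j k"
      by (simp add: det2_def algebra_simps)
  qed
  with q show "det2 A r s i k \<in> P" by simp
qed

text \<open>By linearity in the last column, \<open>u\<close> may be replaced by the proportional
  column \<open>v\<close>; the multiplier is a nonzero entry of \<open>u\<close>.\<close>

lemma perm3_par:
  assumes "par u v" "u < 5" "rows r s t" "perm3 A r s t i j u \<in> P"
  shows "perm3 A r s t i j v \<in> P"
proof -
  obtain r' s' t' where n: "rows r' s' t'" "A r' u \<notin> P" using column_nonzeroE assms(2) by metis
  have "A r' u * perm3 A r' s' t' i j v \<in> P"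
  proof (rule lincomb_mem(2))
    show "perm3 A r' s' t' i j u \<in> P" using assms n by (simp add: perm3_rows)
    show "det2 A r' s' u v \<in> P" "det2 A r' t' u v \<in> P"
      using assms rows_lt[OF n(1)] by (auto simp: par_def)
    show "A r' u * perm3 A r' s' t' i j v = A r' v * perm3 A r' s' t' i j u
       + perm2 A r' t' i j * det2 A r' s' u v + perm2 A r' s' i j * det2 A r' t' u v"
      by (simp add: poly_defs algebra_simps)
  qed
  with n assms show ?thesis by (simp add: perm3_rows)
qed

section \<open>Enumerations of the five columns and criteria for good rows\<close>

definition cols :: "nat \<Rightarrow> nat \<Rightarrow> nat \<Rightarrow> nat \<Rightarrow> nat \<Rightarrow> bool" where
  "cols a b c d e \<longleftrightarrow> distinct [a, b, c, d, e] \<and> {a, b, c, d, e} = {..<5}"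

definition has_good_rows :: bool where
  "has_good_rows \<longleftrightarrow> (\<exists>r s t. rows r s t \<and> good_rows r s)"

lemma cols_lt: "cols a b c d e \<Longrightarrow> a < 5 \<and> b < 5 \<and> c < 5 \<and> d < 5 \<and> e < 5"
  unfolding cols_def by auto

lemma cols_distinct: "cols a b c d e \<Longrightarrow> distinct [a, b, c, d, e]"
  unfolding cols_def by auto

lemma cols_cases: "cols a b c d e \<Longrightarrow> i < 5 \<Longrightarrow> i = a \<or> i = b \<or> i = c \<or> i = d \<or> i = e"
  unfolding cols_def by auto

lemma cols_complete2:
  assumes "i < 5" "j < 5" "i \<noteq> j"
  obtains a b c where "cols i j a b c"
proof -
  have "card ({..<5} - {i, j}) = 3" using assms by (simp add: card_Diff_subset)
  then obtain a b c where abc: "{..<5} - {i, j} = {a, b, c}" "distinct [a, b, c]"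
    by (auto simp: card_3_iff)
  have "{i, j, a, b, c} = {i, j} \<union> {a, b, c}" by auto
  also have "\<dots> = {..<5}" unfolding abc(1)[symmetric] using assms by auto
  finally have "{i, j, a, b, c} = {..<5}" .
  moreover have "x \<noteq> i \<and> x \<noteq> j" if "x \<in> {a, b, c}" for x
    using that unfolding abc(1)[symmetric] by simp
  ultimately have "cols i j a b c" unfolding cols_def using assms(3) abc(2) by auto
  then show ?thesis by (rule that)
qed

lemma cols_complete3:
  assumes "i < 5" "j < 5" "k < 5" "distinct [i, j, k]"
  obtains a b where "cols i j k a b"
proof -
  have "card ({..<5} - {i, j, k}) = 2" using assms by (simp add: card_Diff_subset)
  then obtain a b where ab: "{..<5} - {i, j, k} = {a, b}" "a \<noteq> b"
    by (auto simp: card_2_iff)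
  have "{i, j, k, a, b} = {i, j, k} \<union> {a, b}" by auto
  also have "\<dots> = {..<5}" unfolding ab(1)[symmetric] using assms by auto
  finally have "{i, j, k, a, b} = {..<5}" .
  moreover have "x \<noteq> i \<and> x \<noteq> j \<and> x \<noteq> k" if "x \<in> {a, b}" for x
    using that unfolding ab(1)[symmetric] by simp
  ultimately have "cols i j k a b" unfolding cols_def using assms(4) ab(2) by auto
  then show ?thesis by (rule that)
qed

lemma perm2_sym: "perm2 A r s j i = perm2 A r s i j" "perm2 A s r i j = perm2 A r s i j"
  by (simp_all add: perm2_def algebra_simps)

lemma det2_antisym: "det2 A s r i j = - det2 A r s i j"
  by (simp add: det2_def algebra_simps)

lemma det2_refl: "det2 A r r i j = 0"
  by (simp add: det2_def)

lemma column_nonzero_rows: "rows r s t \<Longrightarrow> j < 5 \<Longrightarrow> \<not> (A r j \<in> P \<and> A s j \<in> P \<and> A t j \<in> P)"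
  using column_nonzero[of j] by (auto simp: rows_def less_Suc_eq numeral_3_eq_3 numeral_2_eq_2)

lemma rows_lt_cases: "rows r s t \<Longrightarrow> q < 3 \<Longrightarrow> q = r \<or> q = s \<or> q = t"
  by (auto simp: rows_def)

lemma parI:
  assumes "rows r s t" "det2 A r s i j \<in> P" "det2 A r t i j \<in> P" "det2 A s t i j \<in> P"
  shows "par i j"
  unfolding par_def
proof (intro allI impI)
  fix q q' :: nat assume "q < 3" "q' < 3"
  then show "det2 A q q' i j \<in> P"
    using rows_lt_cases[OF assms(1), of q] rows_lt_cases[OF assms(1), of q'] assms(2-4)
    by (auto simp: det2_refl det2_antisym[of s r] det2_antisym[of t r] det2_antisym[of t s])
qed

lemma not_parE:
  assumes "\<not> par i j"
  obtains r s t where "rows r s t" "det2 A r s i j \<notin> P"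
proof -
  have R: "rows 0 1 2" "rows 0 2 1" "rows 1 2 0" by (simp_all add: rows_def)
  show ?thesis using parI[OF R(1), of i j] assms that R by blast
qed

lemma perm2_mem_zero: "A r i \<in> P \<Longrightarrow> A s i \<in> P \<Longrightarrow> perm2 A r s i j \<in> P"
  by (simp add: perm2_def add_mem)

lemma good_rowsI:
  assumes "cols a b c d e"
    and "perm2 A r s a b \<in> P" "perm2 A r s a c \<in> P" "perm2 A r s a d \<in> P" "perm2 A r s a e \<in> P"
    and "perm2 A r s b c \<in> P" "perm2 A r s b d \<in> P" "perm2 A r s b e \<in> P"
    and "perm2 A r s c d \<in> P" "perm2 A r s c e \<in> P" "perm2 A r s d e \<in> P"
  shows "good_rows r s"
  unfolding good_rows_def
proof (intro allI impI)
  fix i j :: nat assume lt: "i < 5" "j < 5" and "i \<noteq> j"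
  then show "perm2 A r s i j \<in> P"
    using cols_cases[OF assms(1) lt(1)] cols_cases[OF assms(1) lt(2)]
    by (elim disjE) (use assms(2-) in \<open>simp_all add: perm2_sym(1)\<close>)
qed

lemma zero_row_good:
  assumes "rows r s t" "\<And>i. i < 5 \<Longrightarrow> A t i \<in> P"
  shows has_good_rows
proof -
  have "good_rows t r" using assms(2) by (auto simp: good_rows_def perm2_def intro!: add_mem)
  moreover have "rows t r s" using assms(1) rows_swap by blast
  ultimately show ?thesis unfolding has_good_rows_def by blast
qed

section \<open>Three independent columns\<close>

lemma perm2_from_axis:
  assumes "A s a \<in> P" "A t a \<in> P" "A r a \<notin> P" "perm3 A r s t j k a \<in> P"
  shows "perm2 A s t j k \<in> P"
proof -
  \<comment> \<open>Column \<open>a\<close> is a multiple of a unit vector, so the expansion of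
    \<open>perm3\<close> along it keeps a single term.\<close>
  have "A r a * perm2 A s t j k \<in> P"
    by (rule lincomb_mem(2)[OF assms(4) assms(1) assms(2),
        where ?q1.0 = 1 and ?q2.0 = "- perm2 A r t j k" and ?q3.0 = "- perm2 A r s j k"])
      (simp add: perm3_def algebra_simps)
  with assms show ?thesis by simp
qed

text \<open>In this signed combination two monomials cancel and the third appears twice.\<close>

lemma perm2_prod_rows:
  assumes "perm2 A s t i j \<in> P" "perm2 A r t i j \<in> P" "perm2 A r s i j \<in> P"
  shows "A r i * A s i * A t j \<in> P"
proof -
  have "2 * (A r i * A s i * A t j) \<in> P"
    by (rule lincomb_mem(2)[OF assms,
        where ?q1.0 = "A r i" and ?q2.0 = "A s i" and ?q3.0 = "- A t i"])
      (simp add: perm2_def algebra_simps)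
  then show ?thesis by simp
qed

lemma perm2_prod_cols:
  assumes "perm2 A r s j k \<in> P" "perm2 A r s i k \<in> P" "perm2 A r s i j \<in> P"
  shows "A r i * A r j * A s k \<in> P"
proof -
  have "2 * (A r i * A r j * A s k) \<in> P"
    by (rule lincomb_mem(2)[OF assms,
        where ?q1.0 = "A r i" and ?q2.0 = "A r j" and ?q3.0 = "- A r k"])
      (simp add: perm2_def algebra_simps)
  then show ?thesis by simp
qed

text \<open>Eliminating the term of row \<open>s\<close> between the two expansions leaves
  \<open>perm2 A s t j k\<close> with the coefficient \<open>det2 A r s a b\<close>. As
  \<open>perm2 A r s a b\<close> vanishes, this minor equals
  \<open>2 * A r a * A s b\<close>.\<close>

lemma perm2_from_plane:
  assumes "A t a \<in> P" "A t b \<in> P" "perm2 A r s a b \<in> P" "A r a \<notin> P" "A s b \<notin> P"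
    and "perm3 A r s t j k a \<in> P" "perm3 A r s t j k b \<in> P"
  shows "perm2 A s t j k \<in> P"
proof -
  have "2 * (A r a * A s b * perm2 A s t j k) \<in> P"
    by (rule lincomb_mem(4)[OF assms(6,7,3,1,2), where ?q1.0 = "A s b" and ?q2.0 = "- A s a"
         and ?q3.0 = "perm2 A s t j k" and ?q4.0 = "- A s b * perm2 A r s j k"
         and ?q5.0 = "A s a * perm2 A r s j k"])
      (simp add: poly_defs algebra_simps)
  with assms show ?thesis by simp
qed

lemma det3_mem_zero_row:
  assumes "A r i \<in> P" "A r j \<in> P" "A r k \<in> P"
  shows "det3 A r s t i j k \<in> P"
  by (rule lincomb_mem(2)[OF assms, where ?q1.0 = "det2 A s t j k" and ?q2.0 = "- det2 A s t i k"
       and ?q3.0 = "det2 A s t i j"])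
    (simp add: poly_defs algebra_simps)

text \<open>The determinant gets a zero row. If one of the three entries in row \<open>t\<close>
  vanishes, all do, since otherwise its column would be zero. If none vanishes,
  \<open>perm2_prod_cols\<close> annihilates row \<open>r\<close>.\<close>

lemma det3_mem_perm2:
  assumes rows: "rows r s t" and lt: "c < 5" "d < 5" "e < 5" and dist: "distinct [c, d, e]"
    and rt: "\<And>i j. \<lbrakk>i \<in> {c, d, e}; j \<in> {c, d, e}; i \<noteq> j\<rbrakk> \<Longrightarrow> perm2 A r t i j \<in> P"
    and st: "\<And>i j. \<lbrakk>i \<in> {c, d, e}; j \<in> {c, d, e}; i \<noteq> j\<rbrakk> \<Longrightarrow> perm2 A s t i j \<in> P"
  shows "det3 A r s t c d e \<in> P"
proof (cases "\<exists>i\<in>{c, d, e}. A t i \<in> P")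
  case True
  then obtain i where i: "i \<in> {c, d, e}" "A t i \<in> P" by blast
  have "A t j \<in> P" if j: "j \<in> {c, d, e}" for j
  proof (rule ccontr)
    assume nz: "A t j \<notin> P"
    with i have "i \<noteq> j" by blast
    have "A t j * A q i \<in> P" if "perm2 A q t i j \<in> P" for q
      by (rule lincomb_mem(1)[OF that i(2), where ?q1.0 = 1 and ?q2.0 = "- A q j"])
        (simp add: perm2_def algebra_simps)
    with rt[OF i(1) j \<open>i \<noteq> j\<close>] st[OF i(1) j \<open>i \<noteq> j\<close>] nz have "A r i \<in> P" "A s i \<in> P" by simp_all
    moreover have "i < 5" using i(1) lt by auto
    ultimately show False using i(2) column_nonzero_rows[OF rows] by blast
  qed
  then have "det3 A t r s c d e \<in> P" by (simp add: det3_mem_zero_row)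
  moreover have "det3 A r s t c d e = det3 A t r s c d e" by (simp add: poly_defs algebra_simps)
  ultimately show ?thesis by simp
next
  case False
  have "A t i * A t j * A r k \<in> P"
    if "i \<in> {c, d, e}" "j \<in> {c, d, e}" "k \<in> {c, d, e}" "distinct [i, j, k]" for i j k
    by (rule perm2_prod_cols) (use that in \<open>simp_all add: perm2_sym(2)[of t r] rt\<close>)
  from this[of d e c] this[of c e d] this[of c d e] False dist
  have "A r c \<in> P" "A r d \<in> P" "A r e \<in> P" by auto
  then show ?thesis by (rule det3_mem_zero_row)
qed

text \<open>Columns \<open>a\<close> and \<open>b\<close> lie on the same coordinate axis. Pairs
  meeting them have zero permanents in rows \<open>s\<close>, \<open>t\<close> because of the zero
  entries, the other pairs by \<open>perm2_from_axis\<close>.\<close>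

lemma good_rows_axis:
  assumes "cols a b c d e" "rows r s t"
    and "A s a \<in> P" "A t a \<in> P" "A s b \<in> P" "A t b \<in> P"
  shows has_good_rows
proof -
  have "A r a \<notin> P" using column_nonzero_rows[OF assms(2), of a] assms cols_lt by blast
  have p: "perm2 A s t j k \<in> P" if "j \<in> {c, d, e}" "k \<in> {c, d, e}" "j \<noteq> k" for j k
    by (rule perm2_from_axis[OF assms(3,4) \<open>A r a \<notin> P\<close>], rule perm3_mem[OF assms(2)])
      (use that cols_lt[OF assms(1)] cols_distinct[OF assms(1)] in auto)
  have "good_rows s t"
    using cols_distinct[OF assms(1)]
    by (intro good_rowsI[OF assms(1)]) (simp_all add: p perm2_mem_zero assms)
  then show ?thesis unfolding has_good_rows_def using assms(2) rows_swap by blast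
qed

lemma rank3_good_rows:
  assumes cols: "cols a b c d e" and det: "det3 A 0 1 2 c d e \<notin> P"
  shows has_good_rows
proof -
  have lt: "a < 5" "b < 5" "c < 5" "d < 5" "e < 5" and dist: "distinct [a, b, c, d, e]"
    using cols_lt[OF cols] cols_distinct[OF cols] by auto
  have perm3: "perm3 A r s t i j k \<in> P"
    if "rows r s t" "{i, j, k} \<subseteq> {a, b, c, d, e}" "distinct [i, j, k]" for r s t i j k
    using that lt by (intro perm3_mem) auto
  have ab: "perm2 A r s a b \<in> P" if "rows r s t" for r s t
  proof -
    have "det3 A r s t c d e * perm2 A r s a b \<in> P"
    proof (rule lincomb_mem(2))
      show "perm3 A r s t a b c \<in> P" "perm3 A r s t a b d \<in> P" "perm3 A r s t a b e \<in> P"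
        using that dist by (auto intro!: perm3)
      \<comment> \<open>Cramer's rule: the coefficients are the cofactors of row \<open>t\<close>,
        which isolate the last coordinate of the vector of permanents of \<open>a\<close> and
        \<open>b\<close>.\<close>
      show "det3 A r s t c d e * perm2 A r s a b = det2 A r s d e * perm3 A r s t a b c
         + det2 A r s e c * perm3 A r s t a b d + det2 A r s c d * perm3 A r s t a b e"
        by (simp add: poly_defs algebra_simps)
    qed
    with that det show ?thesis by (simp add: det3_mem_rows)
  qed
  have plane: has_good_rows if r: "rows r s t" and t: "A t a \<in> P" "A t b \<in> P" for r s t
  proof (rule ccontr)
    assume no: "\<not> has_good_rows"
    have rs: "A r a * A s b + A s a * A r b \<in> P" using ab[OF r] by (simp add: perm2_def)
    have nz: "\<not> (A r a \<in> P \<and> A s a \<in> P)" "\<not> (A r b \<in> P \<and> A s b \<in> P)"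
      using column_nonzero_rows[OF r] lt t by blast+
    have no_axis: "\<not> (A r a \<in> P \<and> A r b \<in> P)" "\<not> (A s a \<in> P \<and> A s b \<in> P)"
      using good_rows_axis[OF cols, of s r t] good_rows_axis[OF cols, of r s t] r rows_swap(1)[OF r] t no
      by blast+
    \<comment> \<open>The sum of the two products is in \<open>P\<close>, so both are or neither is.
      One zero among the four entries would then force a second one, against \<open>nz\<close> or
      \<open>no_axis\<close>.\<close>
    have "A r a * A s b \<in> P \<longleftrightarrow> A s a * A r b \<in> P"
      using rs diff_mem[OF rs, of "A r a * A s b"] diff_mem[OF rs, of "A s a * A r b"] 
      by (auto simp del: mult_mem_iff)
    with nz no_axis have ne: "A r a \<notin> P" "A s a \<notin> P" "A r b \<notin> P" "A s b \<notin> P" by auto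
    have r': "rows s r t" using r rows_swap by blast
    have st: "perm2 A s t j k \<in> P" if "j \<in> {c, d, e}" "k \<in> {c, d, e}" "j \<noteq> k" for j k
      by (rule perm2_from_plane[OF t ab[OF r]]) (use ne that dist r in \<open>auto intro!: perm3\<close>)
    have rt: "perm2 A r t j k \<in> P" if "j \<in> {c, d, e}" "k \<in> {c, d, e}" "j \<noteq> k" for j k
      by (rule perm2_from_plane[OF t ab[OF r']]) (use ne that dist r' in \<open>auto intro!: perm3\<close>)
    have "det3 A r s t c d e \<in> P"
      by (rule det3_mem_perm2[OF r lt(3-5) _ rt st]) (use dist in auto)
    with det r show False by (simp add: det3_mem_rows)
  qed
  have R: "rows 0 1 2" "rows 0 2 1" "rows 1 2 0"
    by (simp_all add: rows_def)
  have "A r i * A s i * A t j \<in> P" if "rows r s t" "{i, j} = {a, b}" for r s t i j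
  proof (rule perm2_prod_rows)
    have "perm2 A q q' i j = perm2 A q q' a b" for q q'
      using that(2) by (auto simp: doubleton_eq_iff perm2_sym)
    then show "perm2 A s t i j \<in> P" "perm2 A r t i j \<in> P" "perm2 A r s i j \<in> P"
      using ab[of r s t] ab[of s t r] ab[of r t s] that(1) rows_swap by metis+
  qed
  then have "A r i \<in> P \<or> A s i \<in> P \<or> A t j \<in> P"
    if "rows r s t" "(i, j) \<in> {(a, b), (b, a)}" for r s t i j
    using that by fastforce
  note prod = this[OF R(1)] this[OF R(2)] this[OF R(3)]
  \<comment> \<open>Suppose the zero sets of the two columns were disjoint. By \<open>prod\<close>
    an empty one would make the other column zero, so one of them is a singleton; applying
    \<open>prod\<close> with that row as the last one puts it in the other set as well.\<close>
  have "(A 0 a \<in> P \<and> A 0 b \<in> P) \<or> (A 1 a \<in> P \<and> A 1 b \<in> P) \<or> (A 2 a \<in> P \<and> A 2 b \<in> P)"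
    using prod[of a b] prod[of b a] column_nonzero_rows[OF R(1) lt(1)]
      column_nonzero_rows[OF R(1) lt(2)] by blast
  then show ?thesis using plane[OF R(3)] plane[OF R(2)] plane[OF R(1)] by blast
qed

section \<open>Three proportional columns\<close>

lemma par_zero:
  assumes "par a b" "a < 5" "t < 3" "A t a \<in> P"
  shows "A t b \<in> P"
proof -
  obtain q where q: "q < 3" "A q a \<notin> P" using column_nonzero assms(2) by blast
  have "det2 A q t a b \<in> P" using assms q by (simp add: par_def)
  then have "A q a * A t b \<in> P"
    by (rule lincomb_mem(1)[OF _ assms(4), where ?q1.0 = 1 and ?q2.0 = "A q b"])
      (simp add: det2_def algebra_simps)
  with q show ?thesis by simp
qed

text \<open>Start from \<open>perm3\<close> on the distinct columns \<open>a\<close>,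
  \<open>m\<close>, \<open>b\<close> and replace \<open>b\<close> by the proportional
  \<open>a\<close>. The case \<open>m = c\<close> then allows replacing \<open>c\<close> by
  \<open>a\<close> too.\<close>

lemma triple_perm3:
  assumes cols: "cols a b c d e" and par: "par a b" "par a c" and r: "rows r s t"
    and m: "m \<in> {a, c, d, e}"
  shows "perm3 A r s t a a m \<in> P"
proof -
  have lt: "a < 5" "b < 5" "c < 5" "d < 5" "e < 5" and dist: "distinct [a, b, c, d, e]"
    using cols_lt[OF cols] cols_distinct[OF cols] by auto
  have main: "perm3 A r s t a a m \<in> P" if "m \<in> {c, d, e}" for m
  proof -
    have "perm3 A r s t a m b \<in> P" by (rule perm3_mem[OF r]) (use that lt dist in auto)
    then have "perm3 A r s t a m a \<in> P" by (rule perm3_par[OF par_sym[OF par(1)] lt(2) r])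
    then show ?thesis by (simp add: perm3_cols(2))
  qed
  moreover have "perm3 A r s t a a a \<in> P"
    by (rule perm3_par[OF par_sym[OF par(2)] lt(3) r]) (simp add: main)
  ultimately show ?thesis using m by blast
qed

text \<open>Two zero entries put \<open>a\<close> and \<open>b\<close> on one axis. With a single
  zero, in row \<open>t\<close>, \<open>perm3 A r s t a a m\<close> reduces to
  \<open>2 * A r a * A s a * A t m\<close>, so row \<open>t\<close> vanishes at \<open>d\<close> and
  \<open>e\<close>; at \<open>b\<close> and \<open>c\<close> it vanishes by proportionality.\<close>

lemma triple_good_rows:
  assumes cols: "cols a b c d e" and par: "par a b" "par a c" and r: "rows r s t"
    and zero: "A r a * A s a * A t a \<in> P"
  shows has_good_rows
proof -
  have lt: "a < 5" "b < 5" "c < 5" "d < 5" "e < 5" and dist: "distinct [a, b, c, d, e]"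
    using cols_lt[OF cols] cols_distinct[OF cols] by auto
  have axis: has_good_rows if r: "rows r s t" and st: "A s a \<in> P" "A t a \<in> P" for r s t
    by (rule good_rows_axis[OF cols r st])
      (use st par_zero[OF par(1) lt(1)] rows_lt[OF r] in auto)
  have plane: has_good_rows if r: "rows r s t" and t: "A t a \<in> P" for r s t
  proof (rule ccontr)
    assume no: "\<not> has_good_rows"
    have rs: "A r a \<notin> P" "A s a \<notin> P"
      using axis[of s r t] axis[of r s t] r rows_swap(1)[OF r] t no by blast+
    have "A t m \<in> P" if "m \<in> {d, e}" for m
    proof -
      have T: "perm3 A r s t a a m \<in> P" by (rule triple_perm3[OF cols par r]) (use that in auto)
      have "2 * (A r a * A s a * A t m) \<in> P"
        by (rule lincomb_mem(1)[OF T t, where ?q1.0 = 1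
              and ?q2.0 = "- 2 * (A s a * A r m + A r a * A s m)"])
          (simp add: poly_defs algebra_simps)
      with rs show ?thesis by simp
    qed
    moreover have "A t b \<in> P" "A t c \<in> P"
      using par_zero[OF par(1) lt(1)] par_zero[OF par(2) lt(1)] rows_lt[OF r] t by auto
    ultimately have "A t m \<in> P" if "m < 5" for m
      using cols_cases[OF cols that] t by blast
    with zero_row_good[OF r] no show False by blast
  qed
  have "rows s t r" "rows r t s" using r rows_swap by blast+
  with zero plane[of r s t] plane[of s t r] plane[of r t s] r show ?thesis by auto
qed

text \<open>Once \<open>D\<close> identifies \<open>A s a * A r d\<close> with
  \<open>A r a * A s d\<close>, the form \<open>T\<close> contains
  \<open>2 * A r a * A t a * A s d\<close>; reading this 2 as -1 turns the sum into a multiple of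
  another minor.\<close>

lemma par_char3:
  assumes three: "3 \<in> P" and r: "rows r s t"
    and nz: "A r a \<notin> P" "A s a \<notin> P" "A t a \<notin> P"
    and T: "perm3 A r s t a a d \<in> P" and D: "det2 A r s a d \<in> P"
  shows "par a d"
proof (rule parI[OF r D])
  have "2 * (A r a * det2 A s t a d) \<in> P"
    by (rule lincomb_mem(2)[OF T D three, where ?q1.0 = 1 and ?q2.0 = "2 * A t a"
          and ?q3.0 = "- 2 * A r a * A t a * A s d"])
      (simp add: poly_defs algebra_simps)
  with nz show "det2 A s t a d \<in> P" by simp
  have "2 * (A s a * det2 A r t a d) \<in> P"
    by (rule lincomb_mem(2)[OF T D three, where ?q1.0 = 1 and ?q2.0 = "- 2 * A t a"
          and ?q3.0 = "- 2 * A s a * A t a * A r d"])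
      (simp add: poly_defs algebra_simps)
  with nz show "det2 A r t a d \<in> P" by simp
qed

lemma par_or_par_char3:
  assumes three: "3 \<in> P" and r: "rows r s t"
    and nz: "A r a \<notin> P" "A s a \<notin> P" "A t a \<notin> P"
    and T: "perm3 A r s t a a d \<in> P" "perm3 A r s t a a e \<in> P" "perm3 A r s t d e a \<in> P"
  shows "par a d \<or> par a e"
proof -
  \<comment> \<open>Multiplying the third form by \<open>2 * A r a * A s a\<close> lets the first
    two eliminate \<open>A t d\<close> and \<open>A t e\<close>. What remains factors into the two
    minors modulo 3, the last coefficient being the multiple of 3.\<close>
  have "2 * (A t a * det2 A r s a d * det2 A r s a e) \<in> P"
    by (rule lincomb_mem(3)[OF T three,
          where ?q1.0 = "- (A s a * A r e + A r a * A s e)"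
            and ?q2.0 = "- (A s a * A r d + A r a * A s d)"
            and ?q3.0 = "2 * A r a * A s a"
            and ?q4.0 = "2 * A t a * (A s a * A r d * A s a * A r e + A r a * A s d * A r a * A s e)"])
      (simp add: poly_defs algebra_simps)
  with nz have "det2 A r s a d \<in> P \<or> det2 A r s a e \<in> P" by simp
  with par_char3[OF three r nz] T show ?thesis by blast
qed

lemma triple_char3:
  assumes three: "3 \<in> P" and cols: "cols a b c d e" and par: "par a b" "par a c"
  shows "has_good_rows \<or> par a d \<or> par a e"
proof -
  have r: "rows 0 1 2" by (simp add: rows_def)
  have T: "perm3 A 0 1 2 a a d \<in> P" "perm3 A 0 1 2 a a e \<in> P"
    using triple_perm3[OF cols par r] by auto
  have "perm3 A 0 1 2 d e a \<in> P"
    using cols_lt[OF cols] cols_distinct[OF cols] by (intro perm3_mem[OF r]) auto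
  with triple_good_rows[OF cols par r] par_or_par_char3[OF three r _ _ _ T] show ?thesis
    by auto
qed

lemma triple_not_char3:
  assumes three: "3 \<notin> P" and cols: "cols a b c d e" and par: "par a b" "par a c"
  shows has_good_rows
proof -
  have r: "rows 0 1 2" by (simp add: rows_def)
  have "perm3 A 0 1 2 a a a \<in> P" using triple_perm3[OF cols par r] by simp
  moreover have "perm3 A 0 1 2 a a a = 2 * (3 * (A 0 a * A 1 a * A 2 a))"
    by (simp add: poly_defs algebra_simps)
  ultimately have "A 0 a * A 1 a * A 2 a \<in> P" using three two_not_mem mult_mem_iff by metis
  then show ?thesis by (rule triple_good_rows[OF cols par r])
qed

section \<open>Columns spanning only a plane\<close>

lemma perm3_span:
  assumes "\<not> par a b" "det3 A 0 1 2 a b m \<in> P"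
    and "\<And>r s t. rows r s t \<Longrightarrow> perm3 A r s t i j a \<in> P"
    and "\<And>r s t. rows r s t \<Longrightarrow> perm3 A r s t i j b \<in> P"
    and r: "rows r s t"
  shows "perm3 A r s t i j m \<in> P"
proof -
  obtain r' s' t' where n: "rows r' s' t'" "det2 A r' s' a b \<notin> P" using not_parE assms(1) by blast
  have "det2 A r' s' a b * perm3 A r' s' t' i j m \<in> P"
  proof (rule lincomb_mem(2))
    show "perm3 A r' s' t' i j a \<in> P" "perm3 A r' s' t' i j b \<in> P" using assms n by auto
    show "det3 A r' s' t' a b m \<in> P" using assms(2) n by (simp add: det3_mem_rows)
    \<comment> \<open>Cramer's rule in the rows \<open>r'\<close>, \<open>s'\<close> writes column
      \<open>m\<close> through \<open>a\<close> and \<open>b\<close>; the discrepancy in row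
      \<open>t'\<close> is the determinant \<open>det3\<close>.\<close>
    show "det2 A r' s' a b * perm3 A r' s' t' i j m = det2 A r' s' m b * perm3 A r' s' t' i j a
      + det2 A r' s' a m * perm3 A r' s' t' i j b + perm2 A r' s' i j * det3 A r' s' t' a b m"
      by (simp add: poly_defs algebra_simps)
  qed
  with n r show ?thesis by (simp add: perm3_rows)
qed

text \<open>
  Expand \<open>T(p',p',q')\<close> for the vectors \<open>p' = q\<^sub>s p - p\<^sub>s q\<close> and \<open>q' = p\<^sub>r q - q\<^sub>r p\<close> of the plane, where
  \<open>p'\<^sub>s = q'\<^sub>r = 0\<close> and \<open>p'\<^sub>r = q'\<^sub>s\<close> is the minor in the rows \<open>r\<close>, \<open>s\<close>.
\<close>

lemma det2_zero_of_perm3: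
  assumes "det2 A r s p q \<notin> P" "perm3 A r s t p p p \<in> P" "perm3 A r s t p p q \<in> P"
    "perm3 A r s t p q q \<in> P" "perm3 A r s t q q q \<in> P"
  shows "det2 A s t p q \<in> P"
proof -
  have "2 * (det2 A r s p q * det2 A r s p q * det2 A s t p q) \<in> P"
    by (rule lincomb_mem(3)[OF assms(2-5),
          where ?q1.0 = "A s q * A s q * A r q"
            and ?q2.0 = "- (A s q * A s q * A r p + 2 * A s q * A s p * A r q)"
            and ?q3.0 = "A s p * A s p * A r q + 2 * A s q * A s p * A r p"
            and ?q4.0 = "- (A s p * A s p * A r p)"])
      (simp add: poly_defs algebra_simps)
  with assms(1) show ?thesis by simp
qed

lemma rank2_good_rows:
  assumes det: "\<And>i j k. \<lbrakk>i < 5; j < 5; k < 5; distinct [i, j, k]\<rbrakk> \<Longrightarrow> det3 A 0 1 2 i j k \<in> P"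
    and no_triple: "\<And>i j k. \<lbrakk>i < 5; j < 5; k < 5; distinct [i, j, k]\<rbrakk> \<Longrightarrow> \<not> (par i j \<and> par i k)"
  shows has_good_rows
proof -
  have det': "det3 A 0 1 2 i j k \<in> P" if "i < 5" "j < 5" "k < 5" for i j k
  proof (cases "distinct [i, j, k]")
    case False
    then have "det3 A 0 1 2 i j k = 0" by (auto simp: poly_defs algebra_simps)
    then show ?thesis by simp
  qed (use that det in blast)
  have pair: "(\<not> par i j) \<or> (\<not> par i k)" if "i < 5" "j < 5" "k < 5" "distinct [i, j, k]" for i j k
    using no_triple that by blast
  have perm3_all: "perm3 A r s t i j m \<in> P"
    if ij: "i < 5" "j < 5" "i \<noteq> j" and m: "m < 5" and r: "rows r s t" for i j m r s t
  proof -
    obtain k l n where cols: "cols i j k l n" using cols_complete2[OF ij] .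
    note lt = cols_lt[OF cols] and dist = cols_distinct[OF cols]
    \<comment> \<open>By \<open>pair\<close>, column \<open>k\<close> is independent of
      \<open>l\<close> or of \<open>n\<close>. The form \<open>T(i,j,\<cdot>)\<close> vanishes at
      both chosen columns, hence on the whole plane.\<close>
    obtain l' where l': "l' \<in> {l, n}" "\<not> par k l'" using pair[of k l n] lt dist by auto
    show ?thesis
      by (rule perm3_span[OF l'(2) det' _ _ r])
        (use l' lt dist m in \<open>auto intro!: perm3_mem\<close>)
  qed
  \<comment> \<open>Column 0 is proportional to at most one other column, which leaves three; the
    first of these is proportional to at most one of the other two.\<close>
  obtain p q u where pqu: "p < 5" "q < 5" "u < 5" "\<not> par p q" "\<not> par p u" "\<not> par q u"
  proof -
    obtain y z w where yzw: "y < 5" "z < 5" "w < 5" "distinct [0, y, z, w]"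
      and par0: "\<not> par 0 y" "\<not> par 0 z" "\<not> par 0 w"
    proof -
      have *: "\<not> (par 0 i \<and> par 0 j)" if "i < 5" "j < 5" "distinct [0, i, j]" for i j
        using no_triple that by simp
      consider "par 0 1" | "par 0 2" "\<not> par 0 1" | "\<not> par 0 1" "\<not> par 0 2" by blast
      then show ?thesis
      proof cases
        case 1
        with *[of 1] show ?thesis by (intro that[of 2 3 4]) auto
      next
        case 2
        with *[of 2] show ?thesis by (intro that[of 1 3 4]) auto
      next
        case 3
        with *[of 3 4] show ?thesis
          by (cases "par 0 3") (auto intro: that[of 1 2 4] that[of 1 2 3])
      qed
    qed
    have "\<not> par y z \<or> \<not> par y w" using pair[of y z w] yzw by auto
    then show ?thesis
    proof
      assume "\<not> par y z"
      with yzw par0 show ?thesis by (intro that[of 0 y z]) simp_all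
    next
      assume "\<not> par y w"
      with yzw par0 show ?thesis by (intro that[of 0 y w]) simp_all
    qed
  qed
  \<comment> \<open>\<open>perm3_all\<close> gives the vanishing of \<open>T(i,i,\<cdot>)\<close> at
    \<open>j\<close> and at \<open>k\<close>, and these two columns span the plane.\<close>
  have square: "perm3 A r s t i i m \<in> P"
    if "i < 5" "j < 5" "k < 5" "\<not> par i j" "\<not> par i k" "\<not> par j k" "m < 5" "rows r s t"
    for i j k m r s t
  proof (rule perm3_span[OF that(6) det' _ _ that(8)])
    have ne: "i \<noteq> j" "i \<noteq> k" using that par_refl by auto
    show "perm3 A r s t i i j \<in> P" if "rows r s t" for r s t
      using perm3_all[OF \<open>i < 5\<close> \<open>j < 5\<close> ne(1) \<open>i < 5\<close> that] by (simp add: perm3_cols(2))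
    show "perm3 A r s t i i k \<in> P" if "rows r s t" for r s t
      using perm3_all[OF \<open>i < 5\<close> \<open>k < 5\<close> ne(2) \<open>i < 5\<close> that] by (simp add: perm3_cols(2))
  qed (use that in auto)
  have "\<not> par q p" using pqu par_sym by blast
  have T: "perm3 A r s t p p p \<in> P" "perm3 A r s t p p q \<in> P" "perm3 A r s t p q q \<in> P"
    "perm3 A r s t q q q \<in> P" if "rows r s t" for r s t
  proof -
    show "perm3 A r s t p p p \<in> P" "perm3 A r s t p p q \<in> P"
      using square[of p q u] pqu that by auto
    show "perm3 A r s t q q q \<in> P" using square[of q p u] pqu \<open>\<not> par q p\<close> that by auto
    have "perm3 A r s t q q p \<in> P" using square[of q p u] pqu \<open>\<not> par q p\<close> that by auto
    then show "perm3 A r s t p q q \<in> P" by (simp add: poly_defs algebra_simps)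
  qed
  obtain r s t where r: "rows r s t" and nz: "det2 A r s p q \<notin> P" using not_parE pqu(4) .
  have r': "rows s r t" using r rows_swap by blast
  have st: "det2 A s t p q \<in> P" by (rule det2_zero_of_perm3[OF nz T[OF r]])
  have "det2 A s r p q \<notin> P" using nz by (simp add: det2_antisym[of s r])
  \<comment> \<open>The same argument with rows \<open>r\<close> and \<open>s\<close> exchanged.
    Only the minor in rows \<open>r\<close>, \<open>s\<close> survives, so the plane is the
    coordinate plane where coordinate \<open>t\<close> is zero.\<close>
  then have rt: "det2 A r t p q \<in> P" by (rule det2_zero_of_perm3[OF _ T[OF r']])
  show ?thesis
  proof (rule zero_row_good[OF r])
    fix m :: nat assume "m < 5"
    then have D: "det3 A r s t p q m \<in> P" using det' pqu r by (simp add: det3_mem_rows)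
    have "det2 A r s p q * A t m \<in> P"
      by (rule lincomb_mem(2)[OF D rt st, where ?q1.0 = 1 and ?q2.0 = "A s m"
            and ?q3.0 = "- A r m"])
        (simp add: det3_def algebra_simps)
    with nz show "A t m \<in> P" by simp
  qed
qed

section \<open>Combining the cases by characteristic\<close>

lemma good_rows_or_par_triple:
  assumes "\<not> has_good_rows"
  obtains a b c d e where "cols a b c d e" "par a b" "par a c"
proof -
  have "det3 A 0 1 2 i j k \<in> P" if ijk: "i < 5" "j < 5" "k < 5" "distinct [i, j, k]" for i j k
  proof -
    obtain a b where "cols i j k a b" using ijk by (rule cols_complete3)
    then have "cols a b i j k" by (auto simp: cols_def)
    then show ?thesis using rank3_good_rows assms by blast
  qed
  with rank2_good_rows assms
  obtain i j k where "i < 5" "j < 5" "k < 5" "distinct [i, j, k]" "par i j" "par i k" by blast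
  from this(1-4) obtain d e where "cols i j k d e" by (rule cols_complete3)
  then show ?thesis using that \<open>par i j\<close> \<open>par i k\<close> by blast
qed

lemma has_good_rows_not_char3: "3 \<notin> P \<Longrightarrow> has_good_rows"
  using good_rows_or_par_triple triple_not_char3 by metis

lemma par_columns_char3:
  assumes "3 \<in> P" "\<not> has_good_rows"
  obtains C where "C \<subseteq> {..<5}" "card C = 4" "\<And>i j. i \<in> C \<Longrightarrow> j \<in> C \<Longrightarrow> par i j"
proof -
  obtain a b c d e where cols: "cols a b c d e" and par: "par a b" "par a c"
    using good_rows_or_par_triple assms(2) .
  note lt = cols_lt[OF cols] and dist = cols_distinct[OF cols]
  obtain d' where d': "d' \<in> {d, e}" "par a d'" using triple_char3[OF assms(1) cols par] assms(2) by auto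
  let ?C = "{a, b, c, d'}"
  have "par a i" if "i \<in> ?C" for i using that par d' par_refl by auto
  then have "par i j" if "i \<in> ?C" "j \<in> ?C" for i j
    using that par_trans[of i a j] par_sym[of a i] lt by blast
  moreover have "?C \<subseteq> {..<5}" "card ?C = 4" using d'(1) lt dist by auto
  ultimately show ?thesis using that by blast
qed

end


section \<open>Entries of submatrices\<close>

declare pick.simps [simp del]

lemma card_Collect_less_mem: "S \<subseteq> {..<n} \<Longrightarrow> card {i. i < n \<and> i \<in> S} = card S"
  by (rule arg_cong[where f = card]) auto

lemma submatrix_entry:
  assumes "I \<subseteq> {..<dim_row A}" "J \<subseteq> {..<dim_col A}" "i < card I" "j < card J"
  shows "submatrix A I J $$ (i, j) = A $$ (pick I i, pick J j)"
  using assms by (simp add: submatrix_index card_Collect_less_mem)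

lemma pick_lessThan: "j < n \<Longrightarrow> pick {..<n} j = j"
proof -
  assume "j < n"
  then have "{a \<in> {..<n}. a < j} = {..<j}" by auto
  with pick_card_in_set[of j "{..<n}"] \<open>j < n\<close> show ?thesis by simp
qed

lemma dim_submatrix_card:
  assumes "I \<subseteq> {..<dim_row A}" "J \<subseteq> {..<dim_col A}"
  shows "dim_row (submatrix A I J) = card I" "dim_col (submatrix A I J) = card J"
  using assms by (simp_all add: dim_submatrix card_Collect_less_mem)

text \<open>\<open>pick\<close> enumerates a set increasingly, which makes the two row indices and
  the two column indices distinct.\<close>

lemma permanents_2_submatrixE:
  assumes "p \<in> permanents 2 (submatrix A R {..<dim_col A})" "R \<subseteq> {..<dim_row A}" "card R = 2"
  obtains r s i j where "r \<in> R" "s \<in> R" "r \<noteq> s" "i < dim_col A" "j < dim_col A" "i \<noteq> j"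
    "p = A $$ (r, i) * A $$ (s, j) + A $$ (r, j) * A $$ (s, i)"
proof -
  let ?B = "submatrix A R {..<dim_col A}"
  have dim: "dim_row ?B = 2" "dim_col ?B = dim_col A"
    using dim_submatrix_card[OF assms(2), of "{..<dim_col A}"] assms(3) by simp_all
  obtain I J where IJ: "p = permanent (submatrix ?B I J)" "I \<subseteq> {..<2}" "J \<subseteq> {..<dim_col A}"
    "card I = 2" "card J = 2"
    using assms(1) unfolding permanents_def by (auto simp: dim)
  have J: "pick J 0 \<in> J" "pick J 1 \<in> J" "pick J 0 < pick J 1"
    using pick_in_set_le[of _ J] pick_mono_le[of 1 J 0] IJ(5) by auto
  have I: "pick I 0 \<in> I" "pick I 1 \<in> I" "pick I 0 < pick I 1"
    using pick_in_set_le[of _ I] pick_mono_le[of 1 I 0] IJ(4) by auto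
  then have I': "pick I 0 < 2" "pick I 1 < 2" using IJ(2) by auto
  have R: "pick R i \<in> R" if "i < 2" for i using pick_in_set_le[of i R] assms(3) that by simp
  have Rlt: "pick R (pick I 0) < pick R (pick I 1)" using pick_mono_le[of _ R] I I' assms(3) by simp
  have B: "?B $$ (i, j) = A $$ (pick R i, j)" if "i < 2" "j < dim_col A" for i j
    using that submatrix_entry[OF assms(2), of "{..<dim_col A}" i j] assms(3) by (simp add: pick_lessThan)
  have "submatrix ?B I J $$ (i, j) = A $$ (pick R (pick I i), pick J j)" if "i < 2" "j < 2" for i j
    using submatrix_entry[of I ?B J i j] IJ that pick_in_set_le[of i I] pick_in_set_le[of j J]
    by (subst submatrix_entry) (auto simp: dim intro!: B)
  then have "p = A $$ (pick R (pick I 0), pick J 0) * A $$ (pick R (pick I 1), pick J 1)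
      + A $$ (pick R (pick I 0), pick J 1) * A $$ (pick R (pick I 1), pick J 0)"
    using IJ dim_submatrix_card[of I ?B J] unfolding IJ(1) by (subst permanent_2) (auto simp: dim)
  then show ?thesis using J I' R[of "pick I 0"] R[of "pick I 1"] Rlt IJ(3)
    by (intro that[of "pick R (pick I 0)" "pick R (pick I 1)" "pick J 0" "pick J 1"]) auto
qed

lemma minors_2_submatrixE:
  assumes "m \<in> minors 2 (submatrix A R C)" "R \<subseteq> {..<dim_row A}" "C \<subseteq> {..<dim_col A}"
  obtains r s i j where "r \<in> R" "s \<in> R" "i \<in> C" "j \<in> C"
    "m = A $$ (r, i) * A $$ (s, j) - A $$ (r, j) * A $$ (s, i)"
proof -
  let ?B = "submatrix A R C"
  have dim: "dim_row ?B = card R" "dim_col ?B = card C"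
    using dim_submatrix_card[OF assms(2,3)] by simp_all
  obtain I J where IJ: "m = det (submatrix ?B I J)" "I \<subseteq> {..<card R}" "J \<subseteq> {..<card C}"
    "card I = 2" "card J = 2"
    using assms(1) unfolding minors_def by (auto simp: dim)
  have lt: "pick I i < card R" "pick J i < card C" if "i < 2" for i
    using pick_in_set_le[of i I] pick_in_set_le[of i J] that IJ by auto
  have "submatrix ?B I J $$ (i, j) = A $$ (pick R (pick I i), pick C (pick J j))"
    if "i < 2" "j < 2" for i j
    using submatrix_entry[of I ?B J i j] submatrix_entry[OF assms(2,3), of "pick I i" "pick J j"]
      IJ that lt by (simp add: dim)
  then have "m =
      A $$ (pick R (pick I 0), pick C (pick J 0)) * A $$ (pick R (pick I 1), pick C (pick J 1))
      - A $$ (pick R (pick I 0), pick C (pick J 1)) * A $$ (pick R (pick I 1), pick C (pick J 0))"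
    using IJ dim_submatrix_card[of I ?B J] unfolding IJ(1) by (subst det_2) (auto simp: dim)
  then show ?thesis using lt by (intro that) (auto intro!: pick_in_set_le)
qed

text \<open>The columns are taken in increasing order because \<open>pick\<close> lists a column set
  in that order.\<close>

lemma perm3_mem_permanents:
  assumes "dim_row A = 3" "i < j" "j < k" "k < dim_col A"
  shows "perm3 (\<lambda>r c. A $$ (r, c)) 0 1 2 i j k \<in> permanents 3 A"
proof -
  let ?J = "{i, j, k}" and ?I = "{..<3::nat}"
  have sub: "?I \<subseteq> {..<dim_row A}" "?J \<subseteq> {..<dim_col A}" and cJ: "card ?J = 3"
    using assms by auto
  have I: "pick ?I 0 = 0" "pick ?I 1 = 1" "pick ?I 2 = 2"
    by (rule pick_lessThan; simp)+
  have *: "{a \<in> ?J. a < i} = {}" "{a \<in> ?J. a < j} = {i}" "{a \<in> ?J. a < k} = {i, j}"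
    using assms by auto
  have J: "pick ?J 0 = i" "pick ?J 1 = j" "pick ?J 2 = k"
    using pick_card_in_set[of i ?J] pick_card_in_set[of j ?J] pick_card_in_set[of k ?J] assms(2)
    unfolding * by (simp_all add: numeral_2_eq_2)
  have "permanent (submatrix A ?I ?J) = perm3 (\<lambda>r c. A $$ (r, c)) 0 1 2 i j k"
    using sub cJ I J
    by (subst permanent_3) (simp_all add: dim_submatrix_card submatrix_entry poly_defs algebra_simps)
  then show ?thesis
    unfolding permanents_def using sub cJ by (intro CollectI exI[of _ ?I] exI[of _ ?J]) simp
qed

section \<open>The characteristic\<close>

text \<open>A nonzero constant is a unit, with the constant polynomial of the inverse scalar as its
  inverse, and a prime ideal is proper.\<close>

lemma numeral_poly_mapping_mem:
  fixes P :: "('m::comm_monoid_add \<Rightarrow>\<^sub>0 'k::field) set"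
  assumes "prime_mod P" "(numeral n :: 'k) \<noteq> 0"
  shows "(numeral n :: 'm \<Rightarrow>\<^sub>0 'k) \<notin> P"
proof
  interpret prime_mod P by fact
  assume "(numeral n :: 'm \<Rightarrow>\<^sub>0 'k) \<in> P"
  then have "Poly_Mapping.single 0 (inverse (numeral n :: 'k)) * (numeral n :: 'm \<Rightarrow>\<^sub>0 'k) \<in> P"
    by (rule mult_mem)
  moreover have "Poly_Mapping.single 0 (inverse (numeral n :: 'k)) * (numeral n :: 'm \<Rightarrow>\<^sub>0 'k) = 1"
    by (simp add: single_numeral[symmetric] mult_single assms(2) del: single_numeral)
  ultimately show False using one_not_mem by metis
qed

lemma numeral_prime_eq_zero_iff_CHAR:
  assumes "prime (numeral n :: nat)"
  shows "(numeral n :: 'k::field) = 0 \<longleftrightarrow> CHAR('k) = numeral n"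
proof -
  have "(numeral n :: 'k) = 0 \<longleftrightarrow> CHAR('k) dvd numeral n"
    using of_nat_eq_0_iff_char_dvd[of "numeral n", where 'a = 'k] by simp
  also have "\<dots> \<longleftrightarrow> CHAR('k) = numeral n"
    using assms CHAR_not_1[where 'a = 'k] by (auto simp: prime_nat_iff)
  finally show ?thesis .
qed

section \<open>The generic matrix\<close>

lemma vanishing_permanentsI:
  assumes "primeideal P (ring_of_type_algebra :: 'a::comm_ring_1 ring)" "permanental_ideal 3 M \<subseteq> P"
    and "dim_row M = 3" "dim_col M = 5" "2 \<notin> P" "\<not> (\<exists>j<5. \<forall>i<3. M $$ (i, j) \<in> P)"
  shows "vanishing_permanents P (\<lambda>i j. M $$ (i, j))"
proof -
  interpret prime_mod P using assms(1) by (rule prime_mod.intro)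
  interpret R: ring "ring_of_type_algebra :: 'a ring" by (rule ring_from_type_algebra)
  have "permanents 3 M \<subseteq> P"
    using R.genideal_self[of "permanents 3 M"] assms(2)
    by (auto simp: permanental_ideal_def ring_of_type_algebra_def)
  then have sorted: "perm3 (\<lambda>i j. M $$ (i, j)) 0 1 2 i j k \<in> P" if "i < j" "j < k" "k < 5" for i j k
    using perm3_mem_permanents[OF assms(3) that(1,2)] that(3) assms(4) by auto
  show ?thesis
  proof
    fix i j k :: nat assume lt: "i < 5" "j < 5" "k < 5" and "distinct [i, j, k]"
    let ?p = "perm3 (\<lambda>i j. M $$ (i, j)) 0 1 2"
    \<comment> \<open>Symmetry of \<open>perm3\<close> in its columns extends \<open>sorted\<close>
      from increasing triples to all distinct ones.\<close>
    have "?p j i k = ?p i j k" "?p i k j = ?p i j k" "?p j k i = ?p i j k" "?p k i j = ?p i j k"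
      "?p k j i = ?p i j k"
      by (simp_all add: poly_defs algebra_simps)
    moreover have "i < j \<and> j < k \<or> j < i \<and> i < k \<or> i < k \<and> k < j \<or> j < k \<and> k < i
        \<or> k < i \<and> i < j \<or> k < j \<and> j < i"
      using \<open>distinct [i, j, k]\<close> by auto
    ultimately show "?p i j k \<in> P"
      using sorted[of i j k] sorted[of j i k] sorted[of i k j] sorted[of j k i] sorted[of k i j]
        sorted[of k j i] lt by (elim disjE conjE) simp_all
  qed (use assms in auto)
qed

lemma (in vanishing_permanents) has_good_rows_permanents:
  assumes has_good_rows and M: "A = (\<lambda>i j. M $$ (i, j))" "dim_row M = 3" "dim_col M = 5"
  shows "\<exists>R. R \<subseteq> {..<3} \<and> card R = 2 \<and> permanents 2 (submatrix M R {..<5}) \<subseteq> P"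
proof -
  obtain r s t where r: "rows r s t" "good_rows r s" using assms(1) by (auto simp: has_good_rows_def)
  have rs: "{r, s} \<subseteq> {..<3}" "card {r, s} = 2" using r(1) by (auto simp: rows_def)
  have "permanents 2 (submatrix M {r, s} {..<5}) \<subseteq> P"
  proof
    fix p assume p: "p \<in> permanents 2 (submatrix M {r, s} {..<5})"
    obtain r' s' i j where *: "r' \<in> {r, s}" "s' \<in> {r, s}" "r' \<noteq> s'" "i < 5" "j < 5" "i \<noteq> j"
      "p = A r' i * A s' j + A r' j * A s' i"
      using permanents_2_submatrixE[of p M "{r, s}"] p rs M by metis
    then have "p = perm2 A r s i j" by (auto simp: perm2_def algebra_simps)
    with r(2) *(4-6) show "p \<in> P" unfolding good_rows_def by blast
  qed
  with rs show ?thesis by blast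
qed

theorem theorem8:
  fixes M :: "'k::field poly35 mat"
  assumes "M = generic_matrix_3_5"
  shows "(CHAR('k) \<noteq> 2 \<and> CHAR('k) \<noteq> 3 \<longrightarrow>
          (\<forall>P. minimal_prime_over ring_of_type_algebra (permanental_ideal 3 M) P \<longrightarrow>
             (\<exists>j<5. \<forall>i<3. M $$ (i, j) \<in> P) \<or>
             (\<exists>R. R \<subseteq> {..<3} \<and> card R = 2 \<and> permanents 2 (submatrix M R {..<5}) \<subseteq> P)))
       \<and> (CHAR('k) = 3 \<longrightarrow>
          (\<forall>P. primeideal P ring_of_type_algebra \<and> permanental_ideal 3 M \<subseteq> P \<and>
             \<not> (\<exists>j<5. \<forall>i<3. M $$ (i, j) \<in> P) \<and>
             \<not> (\<exists>R. R \<subseteq> {..<3} \<and> card R = 2 \<and> permanents 2 (submatrix M R {..<5}) \<subseteq> P) \<longrightarrow>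
             (\<exists>C. C \<subseteq> {..<5} \<and> card C = 4 \<and> minors 2 (submatrix M {..<3} C) \<subseteq> P)))"
proof -
  have dim: "dim_row M = 3" "dim_col M = 5" by (simp_all add: assms generic_matrix_3_5_def)
  have vanishing: "vanishing_permanents P (\<lambda>i j. M $$ (i, j))"
    if "CHAR('k) \<noteq> 2" "primeideal P ring_of_type_algebra" "permanental_ideal 3 M \<subseteq> P"
      "\<not> (\<exists>j<5. \<forall>i<3. M $$ (i, j) \<in> P)" for P
  proof -
    have "2 \<notin> P" using that numeral_prime_eq_zero_iff_CHAR[of "num.Bit0 num.One", where 'k = 'k]
      by (intro numeral_poly_mapping_mem prime_mod.intro) auto
    with that dim show ?thesis by (intro vanishing_permanentsI)
  qed
  show ?thesis
  proof (intro conjI impI allI)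
    fix P assume char: "CHAR('k) \<noteq> 2 \<and> CHAR('k) \<noteq> 3"
      and "minimal_prime_over ring_of_type_algebra (permanental_ideal 3 M) P"
    then have P: "primeideal P ring_of_type_algebra" "permanental_ideal 3 M \<subseteq> P"
      by (auto simp: minimal_prime_over_def)
    have "3 \<notin> P" using char P numeral_prime_eq_zero_iff_CHAR[of "num.Bit1 num.One", where 'k = 'k]
      by (intro numeral_poly_mapping_mem prime_mod.intro) auto
    show "(\<exists>j<5. \<forall>i<3. M $$ (i, j) \<in> P) \<or>
      (\<exists>R. R \<subseteq> {..<3} \<and> card R = 2 \<and> permanents 2 (submatrix M R {..<5}) \<subseteq> P)"
    proof (rule disjCI)
      assume no_rows: "\<not> (\<exists>R. R \<subseteq> {..<3} \<and> card R = 2 \<and>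
        permanents 2 (submatrix M R {..<5}) \<subseteq> P)"
      show "\<exists>j<5. \<forall>i<3. M $$ (i, j) \<in> P"
      proof (rule ccontr)
        assume "\<not> (\<exists>j<5. \<forall>i<3. M $$ (i, j) \<in> P)"
        with char P interpret vanishing_permanents P "\<lambda>i j. M $$ (i, j)"
          by (intro vanishing) auto
        show False
          using has_good_rows_permanents[OF has_good_rows_not_char3 refl] \<open>3 \<notin> P\<close> dim no_rows
          by blast
      qed
    qed
  next
    fix P assume char: "CHAR('k) = 3"
      and P: "primeideal P ring_of_type_algebra \<and> permanental_ideal 3 M \<subseteq> P \<and>
             \<not> (\<exists>j<5. \<forall>i<3. M $$ (i, j) \<in> P) \<and>
             \<not> (\<exists>R. R \<subseteq> {..<3} \<and> card R = 2 \<and> permanents 2 (submatrix M R {..<5}) \<subseteq> P)"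
    interpret vanishing_permanents P "\<lambda>i j. M $$ (i, j)" using char P by (intro vanishing) auto
    \<comment> \<open>Read as a constant polynomial, 3 has the coefficient
      \<open>of_nat CHAR('k)\<close>, which is zero.\<close>
    have "(3 :: 'k poly35) = Poly_Mapping.single 0 (of_nat CHAR('k))" by (simp only: char) simp
    then have "3 \<in> P" by simp
    moreover have "\<not> has_good_rows" using has_good_rows_permanents dim P by blast
    ultimately obtain C where C: "C \<subseteq> {..<5}" "card C = 4" "\<And>i j. i \<in> C \<Longrightarrow> j \<in> C \<Longrightarrow> par i j"
      using par_columns_char3 by blast
    have "minors 2 (submatrix M {..<3} C) \<subseteq> P"
    proof
      fix m assume "m \<in> minors 2 (submatrix M {..<3} C)"
      then obtain r s i j where *: "r \<in> {..<3}" "s \<in> {..<3}" "i \<in> C" "j \<in> C"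
        "m = M $$ (r, i) * M $$ (s, j) - M $$ (r, j) * M $$ (s, i)"
        using C(1) dim by (elim minors_2_submatrixE) auto
      then have "m = det2 (\<lambda>i j. M $$ (i, j)) r s i j" by (simp add: det2_def algebra_simps)
      moreover have "r < 3" "s < 3" using * by auto
      ultimately show "m \<in> P" using C(3)[OF *(3,4)] by (simp only: par_def)
    qed
    with C show "\<exists>C. C \<subseteq> {..<5} \<and> card C = 4 \<and> minors 2 (submatrix M {..<3} C) \<subseteq> P" by blast
  qed
qed

end
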